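(* If $Q$ is a periodic product set in $\mathbb{R}^d$, then $H_{\square}(Q,n) \leq 4^d \rho(Q)^2$ for every $n \in \mathbb{N}$.
   Context: A discrete set $A \subseteq \mathbb{R}$ is periodic if there is $p \in \mathbb{R}\setminus\{0\}$ such that $x \in A$ if and only if $x+p \in A$. A discrete set $Q \subseteq \mathbb{R}^d$ is a periodic product set if $Q = A_1\times\cdots\times A_d$ with each $A_i \subseteq \mathbb{R}$ periodic. If $A_i$ has least (positive) period $p_i$, set $m_i(Q) = |A_i \cap [0,p_i)|$ and $\rho(Q) = \prod_{i=1}^d m_i(Q)$ (the number of points of $Q$ in $\prod_{i=1}^d[0,p_i)$). An axis-parallel box in $\mathbb{R}^d$ is a set $\prod_{i=1}^d [x_i,y_i]$ with $x_i\le y_i$. For $S\subseteq\mathbb{R}^d$ and $n\in\mathbb{N}$, $H_{\square}(S,n)$ is the least integer $h$, if it exists, such that for every finite family $\mathcal F$ of convex sets in $\mathbb{R}^d$: if the intersection of any $h$ or fewer members of $\mathcal F$ contains an axis-parallel box containing at least $n$ points of $S$, then $\bigcap\mathcal F$ contains an axis-parallel box containing at least $n$ points of $S$; otherwise $H_{\square}(S,n)=\infty$. *)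

theory Defs
  imports "HOL-Analysis.Analysis" "HOL-Library.Extended_Nat"
begin

text \<open>
  A discrete set need not be closed, so the cardinalities below may be infinite. They are taken
  in \<^typ>\<open>enat\<close>, because \<^const>\<open>card\<close> is \<open>0\<close> on infinite sets.
\<close>

definition ecard :: "'a set \<Rightarrow> enat" where
  "ecard A = (if finite A then enat (card A) else \<infinity>)"

definition is_period :: "real set \<Rightarrow> real \<Rightarrow> bool" where
  "is_period A p \<longleftrightarrow> (\<forall>x. x \<in> A \<longleftrightarrow> x + p \<in> A)"

definition periodic :: "real set \<Rightarrow> bool" where
  "periodic A \<longleftrightarrow> discrete A \<and> (\<exists>p. p \<noteq> 0 \<and> is_period A p)"

text \<open>For periodic \<open>A\<close> the least positive period exists unless \<open>A\<close> is empty.\<close>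

definition least_period :: "real set \<Rightarrow> real" where
  "least_period A = (LEAST p. 0 < p \<and> is_period A p)"

definition periodic_product_set :: "(real ^ 'd) set \<Rightarrow> bool" where
  "periodic_product_set Q \<longleftrightarrow> discrete Q \<and>
     (\<exists>A. (\<forall>i. periodic (A i)) \<and> Q = {x. \<forall>i. x $ i \<in> A i})"

text \<open>
  The factors of a nonempty product set are determined by the set, namely as its coordinate
  projections. All projections of the empty set are empty, so \<open>rho {} = 0\<close>, whatever the value of
  \<open>least_period {}\<close>.
\<close>

definition factor :: "(real ^ 'd) set \<Rightarrow> 'd \<Rightarrow> real set" where
  "factor Q i = (\<lambda>x. x $ i) ` Q"

definition points_per_period :: "(real ^ 'd) set \<Rightarrow> 'd \<Rightarrow> enat" where
  "points_per_period Q i = ecard (factor Q i \<inter> {0..<least_period (factor Q i)})"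

definition rho :: "(real ^ 'd) set \<Rightarrow> enat" where
  "rho Q = (\<Prod>i\<in>UNIV. points_per_period Q i)"

text \<open>
  The condition \<open>x $ i \<le> y $ i\<close> makes the box nonempty; it matters only for \<open>n = 0\<close>.
\<close>

definition contains_box_with :: "(real ^ 'd) set \<Rightarrow> nat \<Rightarrow> (real ^ 'd) set \<Rightarrow> bool" where
  "contains_box_with S n K \<longleftrightarrow>
     (\<exists>x y. (\<forall>i. x $ i \<le> y $ i) \<and> cbox x y \<subseteq> K \<and> enat n \<le> ecard (S \<inter> cbox x y))"

text \<open>
  The subfamily \<open>G\<close> below may be empty, in which case \<open>\<Inter>G\<close> is the whole space.
\<close>

definition box_helly_property :: "(real ^ 'd) set \<Rightarrow> nat \<Rightarrow> nat \<Rightarrow> bool" where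
  "box_helly_property S n h \<longleftrightarrow>
     (\<forall>F. finite F \<and> (\<forall>K\<in>F. convex K) \<and>
          (\<forall>G. G \<subseteq> F \<and> card G \<le> h \<longrightarrow> contains_box_with S n (\<Inter>G))
        \<longrightarrow> contains_box_with S n (\<Inter>F))"

definition box_helly_number :: "(real ^ 'd) set \<Rightarrow> nat \<Rightarrow> enat" where
  "box_helly_number S n =
     (if \<exists>h. box_helly_property S n h then enat (LEAST h. box_helly_property S n h) else \<infinity>)"

end

theory Submission
  imports Defs
begin

text \<open>
  A box with corners \<open>x, y\<close> is a point of \<open>\<real>\<^sup>2\<^sup>d\<close>, and the boxes inside a convex set form a convex set
  there. A box with at least \<open>n \<ge> 1\<close> points of \<open>Q\<close> shrinks to one with corners in \<open>Q\<close>, so the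
  question is about the locally finite set \<open>T\<close> of such corner pairs. Reducing every coordinate modulo
  twice its period divides \<open>T\<close> into at most \<open>4\<^sup>d \<rho>(Q)\<^sup>2\<close> classes. Two boxes in one class have
  their midpoint in \<open>T\<close>: the number of points along each axis is the average of those of the two
  boxes, and the product of the averages is at least \<open>n\<close> by the inequality of the arithmetic and
  geometric means. As in the proof of Doignon's theorem, a set such that any \<open>N + 1\<close> of its points
  include two whose midpoint is again in the set has Helly number at most \<open>N\<close>. For \<open>n = 0\<close> the claim
  follows from the classical Helly theorem.
\<close>

section \<open>Helly numbers of sets with many midpoints\<close>

text \<open>The halfspace case: \<open>none\<close> and \<open>crit\<close> make the open halfspaces
  \<open>a i \<bullet> t < b i\<close> a minimal family without a common point in
  \<open>T\<close>.\<close>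

lemma card_le_if_midpoints_and_halfspaces:
  fixes a :: "'i \<Rightarrow> 'v::real_inner" and b :: "'i \<Rightarrow> real"
  assumes "finite T" "finite I"
    and mid: "\<And>S. S \<subseteq> T \<Longrightarrow> N < card S \<Longrightarrow> \<exists>x\<in>S. \<exists>y\<in>S. x \<noteq> y \<and> midpoint x y \<in> T"
    and none: "\<And>t. t \<in> T \<Longrightarrow> \<exists>i\<in>I. b i \<le> a i \<bullet> t"
    and crit: "\<And>i. i \<in> I \<Longrightarrow> \<exists>t\<in>T. \<forall>j\<in>I-{i}. a j \<bullet> t < b j"
  shows "card I \<le> N"
proof -
  \<comment> \<open>Push the bounding hyperplanes outwards as far as \<open>none\<close> permits; then each of them contains a
    point of \<open>T\<close> satisfying the other inequalities, and the midpoint of two such points violates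
    \<open>none\<close>.\<close>
  define P where "P = (\<lambda>c. (\<forall>i\<in>I. b i \<le> c i) \<and> (\<forall>t\<in>T. \<exists>i\<in>I. c i \<le> a i \<bullet> t))"
  \<comment> \<open>A bounded potential: it counts the points of \<open>T\<close> on the closed
    inner side of each hyperplane, so some admissible \<open>c\<close> maximises it.\<close>
  define f where "f = (\<lambda>c. \<Sum>i\<in>I. card {t \<in> T. a i \<bullet> t \<le> c i})"
  have "f c < Suc (card I * card T)" for c
    unfolding f_def less_Suc_eq_le
    by (rule sum_bounded_above[THEN order_trans]) (auto intro: card_mono assms)
  moreover have "P b"
    using none by (auto simp: P_def)
  ultimately obtain c where Pc: "P c" and max: "\<And>d. P d \<Longrightarrow> f d \<le> f c"
    using ex_has_greatest_nat[of P b f] by (metis less_or_eq_imp_le)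
  have "\<exists>t. t \<in> T \<and> a i \<bullet> t = c i \<and> (\<forall>j\<in>I-{i}. a j \<bullet> t < c j)" if i: "i \<in> I" for i
  proof -
    define U where "U = {t \<in> T. \<forall>j\<in>I-{i}. a j \<bullet> t < c j}"
    have U: "finite U" "U \<noteq> {}"
      using crit[OF i] Pc \<open>finite T\<close> unfolding U_def P_def
      by (auto intro: less_le_trans)
    define t where "t = arg_min_on (\<lambda>t. a i \<bullet> t) U"
    have t: "t \<in> U" "\<And>u. u \<in> U \<Longrightarrow> a i \<bullet> t \<le> a i \<bullet> u"
      using arg_min_if_finite[OF U, of "\<lambda>t. a i \<bullet> t"] unfolding t_def
      by (auto simp: not_less)
    have "c i \<le> a i \<bullet> t"
      using t(1) Pc unfolding U_def P_def
      by (smt (verit) Diff_iff mem_Collect_eq singletonD)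
    \<comment> \<open>Otherwise hyperplane \<open>i\<close> can be moved out to \<open>t\<close>:
      points of \<open>U\<close> stay excluded because \<open>t\<close> is lowest among them, and
      the other points of \<open>T\<close> violate another inequality. The move adds
      \<open>t\<close> to the count in \<open>f\<close>, against maximality.\<close>
    moreover have "\<not> c i < a i \<bullet> t"
    proof
      assume less: "c i < a i \<bullet> t"
      define d where "d = c(i := a i \<bullet> t)"
      have "\<exists>j\<in>I. d j \<le> a j \<bullet> u" if u: "u \<in> T" for u
      proof (cases "u \<in> U")
        case True
        then show ?thesis using t(2) i by (auto simp: d_def)
      next
        case False
        then obtain j where "j \<in> I - {i}" "c j \<le> a j \<bullet> u"
          using u by (auto simp: U_def not_less)
        then show ?thesis by (auto simp: d_def)
      qed
      moreover have "\<forall>j\<in>I. b j \<le> d j"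
        using Pc less unfolding P_def d_def by force
      ultimately have "f d \<le> f c"
        using max unfolding P_def by blast
      moreover have "f c < f d"
        unfolding f_def
      proof (rule sum_strict_mono_ex1)
        show "\<forall>j\<in>I. card {t \<in> T. a j \<bullet> t \<le> c j} \<le> card {t \<in> T. a j \<bullet> t \<le> d j}"
          using \<open>finite T\<close> less by (auto simp: d_def intro!: card_mono)
        have "t \<in> {t \<in> T. a i \<bullet> t \<le> d i} - {t \<in> T. a i \<bullet> t \<le> c i}"
          using less t(1) by (auto simp: d_def U_def)
        moreover have "{t \<in> T. a i \<bullet> t \<le> c i} \<subseteq> {t \<in> T. a i \<bullet> t \<le> d i}"
          using less by (auto simp: d_def)
        ultimately have "{t \<in> T. a i \<bullet> t \<le> c i} \<subset> {t \<in> T. a i \<bullet> t \<le> d i}"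
          by blast
        then show "\<exists>j\<in>I. card {t \<in> T. a j \<bullet> t \<le> c j} < card {t \<in> T. a j \<bullet> t \<le> d j}"
          using i \<open>finite T\<close> by (intro bexI[of _ i] psubset_card_mono) auto
      qed (fact \<open>finite I\<close>)
      ultimately show False by simp
    qed
    ultimately show ?thesis
      using t(1) by (intro exI[of _ t]) (auto simp: U_def)
  qed
  then obtain t where t: "\<And>i. i \<in> I \<Longrightarrow> t i \<in> T" "\<And>i. i \<in> I \<Longrightarrow> a i \<bullet> t i = c i"
      "\<And>i j. i \<in> I \<Longrightarrow> j \<in> I \<Longrightarrow> j \<noteq> i \<Longrightarrow> a j \<bullet> t i < c j"
    by (metis DiffI singletonD)
  have le: "a k \<bullet> t i \<le> c k" if "k \<in> I" "i \<in> I" for k i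
    using t that by (cases "k = i") (auto intro: less_imp_le)
  have "inj_on t I"
    by (intro inj_onI) (metis t(2,3) less_irrefl)
  show ?thesis
  proof (rule ccontr)
    assume "\<not> card I \<le> N"
    then have "N < card (t ` I)"
      using \<open>inj_on t I\<close> by (simp add: card_image)
    then obtain i j where ij: "i \<in> I" "j \<in> I" "t i \<noteq> t j" and m: "midpoint (t i) (t j) \<in> T"
      using mid[of "t ` I"] t(1) by blast
    \<comment> \<open>Hyperplane \<open>k\<close> contains at most one of the two points and the
      other lies strictly inside, hence so does the midpoint.\<close>
    have "a k \<bullet> midpoint (t i) (t j) < c k" if k: "k \<in> I" for k
    proof -
      have "a k \<bullet> t i < c k \<or> a k \<bullet> t j < c k"
        using t(3) ij k by metis
      then have "a k \<bullet> t i + a k \<bullet> t j < 2 * c k"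
        using le[OF k ij(1)] le[OF k ij(2)] by linarith
      then show ?thesis
        by (simp add: midpoint_def inner_add_right)
    qed
    then show False
      using Pc m unfolding P_def by (meson not_le)
  qed
qed

text \<open>Two reductions lead to the previous lemma: from \<open>T\<close> to its finitely many
  points in a convex hull of witnesses, and from convex sets to halfspaces separating them from
  excluded points.\<close>

lemma helly_locally_finite:
  fixes C :: "'k \<Rightarrow> 'v::euclidean_space set"
  assumes loc: "\<And>B. bounded B \<Longrightarrow> finite (T \<inter> B)"
    and mid: "\<And>S. S \<subseteq> T \<Longrightarrow> N < card S \<Longrightarrow> \<exists>x\<in>S. \<exists>y\<in>S. x \<noteq> y \<and> midpoint x y \<in> T"
    and "finite F" and conv: "\<And>K. K \<in> F \<Longrightarrow> convex (C K)"
    and sub: "\<And>G. G \<subseteq> F \<Longrightarrow> card G \<le> N \<Longrightarrow> \<exists>t\<in>T. \<forall>K\<in>G. t \<in> C K"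
  shows "\<exists>t\<in>T. \<forall>K\<in>F. t \<in> C K"
proof (rule ccontr)
  assume contra: "\<not> ?thesis"
  obtain p where p: "\<And>G. G \<subseteq> F \<Longrightarrow> card G \<le> N \<Longrightarrow> p G \<in> T \<and> (\<forall>K\<in>G. p G \<in> C K)"
    using sub by metis
  \<comment> \<open>Boundedness of \<open>H\<close> makes \<open>T0\<close> finite, convexity keeps
    midpoints in it, and every small subfamily still has a witness there.\<close>
  define H where "H = convex hull (p ` Pow F)"
  define T0 where "T0 = T \<inter> H"
  have "finite T0"
    unfolding T0_def H_def using \<open>finite F\<close>
    by (intro loc bounded_convex_hull finite_imp_bounded) auto
  have mid0: "\<exists>x\<in>S. \<exists>y\<in>S. x \<noteq> y \<and> midpoint x y \<in> T0" if "S \<subseteq> T0" "N < card S" for S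
  proof -
    have "S \<subseteq> T" "S \<subseteq> H"
      using that(1) by (auto simp: T0_def)
    then obtain x y where xy: "x \<in> S" "y \<in> S" "x \<noteq> y" "midpoint x y \<in> T"
      using mid[of S] \<open>N < card S\<close> by blast
    moreover have "midpoint x y \<in> H"
      using closed_segment_subset[of x H y] midpoints_in_convex_hull[of x "p ` Pow F" y] xy(1,2) \<open>S \<subseteq> H\<close>
      by (auto simp: H_def)
    ultimately show ?thesis by (auto simp: T0_def)
  qed
  have sub0: "\<exists>t\<in>T0. \<forall>K\<in>G. t \<in> C K" if "G \<subseteq> F" "card G \<le> N" for G
    using p[OF that] that(1) by (auto simp: T0_def H_def intro!: bexI[of _ "p G"] hull_inc)
  \<comment> \<open>Some \<open>C K\<close> misses \<open>z\<close>. The hull of the finite set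
    \<open>C K \<inter> T0\<close> is compact and stays inside \<open>C K\<close>, so a hyperplane,
    stored as the pair \<open>w\<close> of normal and offset, separates it from
    \<open>z\<close>.\<close>
  have "\<exists>w K. K \<in> F \<and> snd w \<le> fst w \<bullet> z \<and> (\<forall>x\<in>C K \<inter> T0. fst w \<bullet> x < snd w)"
    if z: "z \<in> T0" for z
  proof -
    obtain K where K: "K \<in> F" "z \<notin> C K"
      using contra z by (auto simp: T0_def)
    let ?D = "convex hull (C K \<inter> T0)"
    have "?D \<subseteq> C K"
      by (simp add: hull_minimal conv K)
    moreover have "closed ?D"
      using \<open>finite T0\<close> by (intro compact_imp_closed finite_imp_compact_convex_hull) simp
    ultimately obtain a b where ab: "a \<bullet> z < b" "\<And>x. x \<in> ?D \<Longrightarrow> b < a \<bullet> x"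
      using separating_hyperplane_closed_point[OF convex_convex_hull, of _ z] K by blast
    have "b < a \<bullet> x" if "x \<in> C K \<inter> T0" for x
      using ab(2) that by (simp add: hull_inc)
    then show ?thesis
      using ab(1) K(1) by (intro exI[of _ "(-a, -b)"] exI[of _ K]) auto
  qed
  then obtain w k where w: "\<And>z. z \<in> T0 \<Longrightarrow> k z \<in> F" "\<And>z. z \<in> T0 \<Longrightarrow> snd (w z) \<le> fst (w z) \<bullet> z"
      "\<And>z x. z \<in> T0 \<Longrightarrow> x \<in> T0 \<Longrightarrow> x \<in> C (k z) \<Longrightarrow> fst (w z) \<bullet> x < snd (w z)"
    by (metis IntI)
  \<comment> \<open>The halfspaces \<open>w z\<close> exclude all of \<open>T0\<close>; a minimal subfamily with this property has at most
    \<open>N\<close> members.\<close>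
  define P where "P = (\<lambda>V. V \<subseteq> T0 \<and> (\<forall>t\<in>T0. \<exists>z\<in>V. snd (w z) \<le> fst (w z) \<bullet> t))"
  have "P T0"
    using w(2) by (auto simp: P_def)
  then obtain V where V: "P V" and min: "\<And>U. P U \<Longrightarrow> card V \<le> card U"
    using ex_has_least_nat[of P T0 card] by auto
  have "finite V"
    using V \<open>finite T0\<close> by (auto simp: P_def intro: finite_subset)
  have "card V \<le> N"
  proof (rule card_le_if_midpoints_and_halfspaces[OF \<open>finite T0\<close> \<open>finite V\<close>])
    show "\<exists>i\<in>V. snd (w i) \<le> fst (w i) \<bullet> t" if "t \<in> T0" for t
      using V that by (auto simp: P_def)
    show "\<exists>t\<in>T0. \<forall>j\<in>V - {i}. fst (w j) \<bullet> t < snd (w j)" if i: "i \<in> V" for i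
    proof -
      have "card (V - {i}) < card V"
        using \<open>finite V\<close> i by (rule card_Diff1_less)
      then have "\<not> P (V - {i})"
        using min by (meson not_le)
      then show ?thesis
        using V by (auto simp: P_def not_le) 
    qed
  qed (rule mid0)
  then have "card (k ` V) \<le> N"
    using card_image_le[OF \<open>finite V\<close>, of k] by linarith
  moreover have "k ` V \<subseteq> F"
    using V w(1) by (auto simp: P_def)
  \<comment> \<open>A common point of these sets in \<open>T0\<close> satisfies all inequalities of
    \<open>V\<close>, although \<open>V\<close> excludes all of \<open>T0\<close>.\<close>
  ultimately obtain t where "t \<in> T0" "\<And>z. z \<in> V \<Longrightarrow> t \<in> C (k z)"
    using sub0[of "k ` V"] by auto
  then show False
    using V w(3)[of _ t] by (fastforce simp: P_def)
qed

section \<open>Periodic sets of reals\<close>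

lemma is_periodD: "is_period A p \<Longrightarrow> x + p \<in> A \<longleftrightarrow> x \<in> A"
  by (simp add: is_period_def)

lemma is_period_uminus: "is_period A p \<Longrightarrow> is_period A (- p)"
  unfolding is_period_def by (metis diff_add_cancel uminus_add_conv_diff add.commute)

lemma is_period_add: "is_period A p \<Longrightarrow> is_period A q \<Longrightarrow> is_period A (p + q)"
  by (simp add: is_period_def flip: add.assoc)

lemma is_period_diff: "is_period A p \<Longrightarrow> is_period A q \<Longrightarrow> is_period A (p - q)"
  using is_period_add[of A p "- q"] is_period_uminus[of A q] by simp

lemma is_period_int_mult:
  assumes "is_period A p"
  shows "is_period A (of_int k * p)"
proof (induction k rule: int_induct[where k = 0])
  case base
  then show ?case by (simp add: is_period_def)
next
  case (step1 i)
  then show ?case using is_period_add[OF _ assms, of "of_int i * p"] by (simp add: algebra_simps)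
next
  case (step2 i)
  then show ?case using is_period_diff[OF _ assms] by (simp add: algebra_simps)
qed

text \<open>Discreteness at one point bounds all positive periods below by some \<open>e\<close>. If
  the infimum were not attained, two periods less than \<open>e\<close> apart would have a positive
  period below \<open>e\<close> as their difference.\<close>

lemma least_period:
  assumes "periodic A" "A \<noteq> {}"
  shows "0 < least_period A" "is_period A (least_period A)"
proof -
  define P where "P = {p. 0 < p \<and> is_period A p}"
  obtain q where "q \<noteq> 0" "is_period A q"
    using assms(1) by (auto simp: periodic_def)
  then have "q \<in> P \<or> - q \<in> P"
    using is_period_uminus[of A q] by (auto simp: P_def)
  then have "P \<noteq> {}" by auto
  obtain a where a: "a \<in> A" using assms(2) by auto
  obtain e where e: "0 < e" "\<And>y. y \<in> A \<Longrightarrow> dist a y < e \<Longrightarrow> y = a"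
    using assms(1) a unfolding periodic_def discrete_def isolated_in_dist_Ex_iff by blast
  have le: "e \<le> r" if "r \<in> P" for r
    using e(2)[of "a + r"] that a is_periodD[of A r a] by (force simp: P_def dist_real_def)
  then have bdd: "bdd_below P" by (auto simp: bdd_below_def)
  have "Inf P \<in> P"
  proof -
    obtain r where r: "r \<in> P" "r < Inf P + e"
      using cInf_lessD[OF \<open>P \<noteq> {}\<close>, of "Inf P + e"] e(1) by auto
    have "r = Inf P"
    proof (rule ccontr)
      assume "r \<noteq> Inf P"
      then have "Inf P < r"
        using cInf_lower[OF r(1) bdd] by simp
      then obtain s where s: "s \<in> P" "s < r"
        using cInf_lessD[OF \<open>P \<noteq> {}\<close>] by auto
      then have "r - s \<in> P"
        using r(1) is_period_diff by (auto simp: P_def)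
      then show False
        using le[of "r - s"] r(2) cInf_lower[OF s(1) bdd] by simp
    qed
    then show ?thesis using r by simp
  qed
  moreover have "least_period A = Inf P"
    unfolding least_period_def
    by (rule Least_equality) (use \<open>Inf P \<in> P\<close> cInf_lower[OF _ bdd] in \<open>auto simp: P_def\<close>)
  ultimately show "0 < least_period A" "is_period A (least_period A)"
    by (auto simp: P_def)
qed

lemma is_period_Int_image:
  assumes "is_period A u"
  shows "A \<inter> (\<lambda>t. t + u) ` S = (\<lambda>t. t + u) ` (A \<inter> S)"
  using is_periodD[OF assms] by auto

lemma card_is_period_shift:
  assumes "is_period A u"
  shows "card (A \<inter> (\<lambda>t. t + u) ` S) = card (A \<inter> S)"
  unfolding is_period_Int_image[OF assms] by (intro card_image inj_onI) simp

lemma finite_periodic_Icc: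
  assumes "is_period A p" "0 < p" "finite (A \<inter> {0..<p})"
  shows "finite (A \<inter> {a..b})"
proof (rule finite_subset)
  show "A \<inter> {a..b} \<subseteq> (\<Union>k\<in>{\<lfloor>a / p\<rfloor>..\<lfloor>b / p\<rfloor>}. (\<lambda>t. t + of_int k * p) ` (A \<inter> {0..<p}))"
  proof
    fix t assume t: "t \<in> A \<inter> {a..b}"
    let ?k = "\<lfloor>t / p\<rfloor>"
    have "?k \<in> {\<lfloor>a / p\<rfloor>..\<lfloor>b / p\<rfloor>}"
      using t assms(2) by (auto intro!: floor_mono divide_right_mono)
    moreover have "of_int ?k * p \<le> t"
      using assms(2) of_int_floor_le[of "t / p"] by (simp add: le_divide_eq)
    moreover have "t < (of_int ?k + 1) * p"
      using pos_divide_less_eq[OF assms(2), of t "of_int ?k + 1"] by simp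
    moreover have "t - of_int ?k * p \<in> A"
      using is_periodD[OF is_period_int_mult[OF assms(1), of ?k], of "t - of_int ?k * p"] t by simp
    ultimately show "t \<in> (\<Union>k\<in>{\<lfloor>a / p\<rfloor>..\<lfloor>b / p\<rfloor>}. (\<lambda>t. t + of_int k * p) ` (A \<inter> {0..<p}))"
      by (intro UN_I[of ?k] image_eqI[of _ _ "t - of_int ?k * p"]) (auto simp: algebra_simps)
  qed
qed (use assms(3) in auto)

lemma card_periodic_double:
  assumes "is_period A p" "0 < p" "finite (A \<inter> {0..<p})"
  shows "card (A \<inter> {0..<2 * p}) = 2 * card (A \<inter> {0..<p})"
proof -
  have shift: "{p..<2 * p} = (\<lambda>t. t + p) ` {0..<p}"
    by simp
  have "A \<inter> {0..<2 * p} = A \<inter> {0..<p} \<union> A \<inter> {p..<2 * p}"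
    using assms(2) by auto
  also have "card \<dots> = card (A \<inter> {0..<p}) + card (A \<inter> {p..<2 * p})"
    using assms(3) unfolding shift is_period_Int_image[OF assms(1)]
    by (intro card_Un_disjoint) auto
  also have "card (A \<inter> {p..<2 * p}) = card (A \<inter> {0..<p})"
    unfolding shift by (rule card_is_period_shift[OF assms(1)])
  finally show ?thesis by simp
qed

text \<open>Translation by periods fixes the left end and leaves the intervals from \<open>x\<close>
  to \<open>y\<close>, \<open>y + q\<close> and \<open>y + 2 * q\<close>. Their counts form an
  arithmetic progression, because the two added pieces are translates of each other by
  \<open>q\<close>.\<close>

lemma card_periodic_midpoint_aux:
  assumes "is_period A u" "is_period A v" "\<And>a b. finite (A \<inter> {a..b})"
    and "x \<le> y" "u \<le> v"
  shows "card (A \<inter> {x..y}) + card (A \<inter> {x + 2 * u..y + 2 * v}) = 2 * card (A \<inter> {x + u..y + v})"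
proof -
  define q where "q = v - u"
  have q: "is_period A q" "0 \<le> q"
    using assms by (auto simp: q_def is_period_diff)
  have split: "card (A \<inter> {x..b}) = card (A \<inter> {x..a}) + card (A \<inter> {a<..b})" if "x \<le> a" "a \<le> b" for a b
  proof -
    have "A \<inter> {x..b} = A \<inter> {x..a} \<union> A \<inter> {a<..b}"
      using that by auto
    moreover have "finite (A \<inter> {a<..b})"
      by (rule finite_subset[OF _ assms(3)[of a b]]) auto
    ultimately show ?thesis
      using assms(3) by (auto intro!: card_Un_disjoint)
  qed
  have "{y + q<..y + 2 * q} = (\<lambda>t. t + q) ` {y<..y + q}"
    by (auto intro!: image_eqI[of _ _ "_ - q"])
  then have "card (A \<inter> {y + q<..y + 2 * q}) = card (A \<inter> {y<..y + q})"
    by (simp only: card_is_period_shift[OF q(1)])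
  moreover have "card (A \<inter> {x + u..y + v}) = card (A \<inter> {x..y + q})"
    using card_is_period_shift[OF assms(1), of "{x..y + q}"] by (simp add: q_def algebra_simps)
  moreover have "card (A \<inter> {x + 2 * u..y + 2 * v}) = card (A \<inter> {x..y + 2 * q})"
    using card_is_period_shift[OF is_period_add[OF assms(1,1)], of "{x..y + 2 * q}"]
    by (simp add: q_def algebra_simps)
  ultimately show ?thesis
    using split[of y "y + q"] split[of "y + q" "y + 2 * q"] assms(4) q(2) by simp
qed

lemma card_periodic_midpoint:
  assumes "is_period A u" "is_period A v" "\<And>a b. finite (A \<inter> {a..b})"
    and "x \<le> y" "x + 2 * u \<le> y + 2 * v"
  shows "card (A \<inter> {x..y}) + card (A \<inter> {x + 2 * u..y + 2 * v}) = 2 * card (A \<inter> {x + u..y + v})"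
proof (cases "u \<le> v")
  case True
  then show ?thesis
    using assms by (intro card_periodic_midpoint_aux)
next
  \<comment> \<open>The same identity read from the other interval, with both shifts
    reversed.\<close>
  case False
  have [simp]: "z + 2 * w - w = z + w" for z w :: real
    by simp
  show ?thesis
    using card_periodic_midpoint_aux[of A "- u" "- v" "x + 2 * u" "y + 2 * v"] False assms
    by (simp add: is_period_uminus)
qed

section \<open>Product sets and boxes\<close>

lemma bij_betw_vec_nth_PiE:
  "bij_betw vec_nth {x :: 'a ^ 'd. \<forall>i. x $ i \<in> B i} (PiE UNIV B)"
proof (rule bij_betw_imageI)
  show "vec_nth ` {x :: 'a ^ 'd. \<forall>i. x $ i \<in> B i} = PiE UNIV B"
    by (auto simp: PiE_def intro!: image_eqI[of _ _ "vec_lambda _"])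
qed (simp add: inj_on_def vec_nth_inject)

lemma card_vec_product: "card {x :: 'a ^ 'd. \<forall>i. x $ i \<in> B i} = (\<Prod>i\<in>UNIV. card (B i))"
  using bij_betw_same_card[OF bij_betw_vec_nth_PiE, of B] by (simp add: card_PiE)

lemma finite_vec_product:
  "(\<And>i. finite (B i)) \<Longrightarrow> finite {x :: 'a ^ 'd. \<forall>i. x $ i \<in> B i}"
  using bij_betw_finite[OF bij_betw_vec_nth_PiE, of B] by (simp add: finite_PiE)

lemma prod_card_average_ge:
  fixes a b c :: "'i \<Rightarrow> nat"
  assumes "n \<le> (\<Prod>i\<in>I. a i)" "n \<le> (\<Prod>i\<in>I. b i)" "\<And>i. i \<in> I \<Longrightarrow> a i + b i = 2 * c i"
  shows "n \<le> (\<Prod>i\<in>I. c i)"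
proof -
  have "a i * b i \<le> (c i)\<^sup>2" if "i \<in> I" for i
  proof -
    \<comment> \<open>The AM-GM inequality, over \<open>int\<close> because subtraction on
      \<open>nat\<close> truncates.\<close>
    have "4 * (int (a i) * int (b i)) \<le> (int (a i) + int (b i))\<^sup>2"
      using zero_le_power2[of "int (a i) - int (b i)"] by (simp add: power2_eq_square algebra_simps)
    also have "int (a i) + int (b i) = 2 * int (c i)"
      using assms(3)[OF that] by linarith
    finally have "int (a i * b i) \<le> int ((c i)\<^sup>2)"
      by (simp add: power2_eq_square)
    then show ?thesis by linarith
  qed
  then have "(\<Prod>i\<in>I. a i * b i) \<le> (\<Prod>i\<in>I. (c i)\<^sup>2)"
    by (intro prod_mono) auto
  moreover have "n * n \<le> (\<Prod>i\<in>I. a i * b i)"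
    using assms(1,2) by (simp add: prod.distrib mult_le_mono)
  ultimately have "n\<^sup>2 \<le> (\<Prod>i\<in>I. c i)\<^sup>2"
    by (simp add: power2_eq_square prod.distrib)
  then show ?thesis
    by (simp add: power2_nat_le_eq_le)
qed

text \<open>Boxes become points of a vector space, so that a set of boxes can be convex. The order
  condition keeps out inverted pairs, whose empty \<open>cbox\<close> lies in every
  \<open>K\<close>.\<close>

definition box_pairs :: "(real ^ 'd) set \<Rightarrow> ((real ^ 'd) \<times> (real ^ 'd)) set" where
  "box_pairs K = {(x, y). (\<forall>i. x $ i \<le> y $ i) \<and> cbox x y \<subseteq> K}"

text \<open>Each point of a convex combination of two boxes is the same combination of two points,
  one from each box, with equal relative positions \<open>\<theta>\<close> along every axis.\<close>

lemma convex_box_pairs: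
  fixes K :: "(real ^ 'd) set"
  assumes "convex K"
  shows "convex (box_pairs K)"
  unfolding box_pairs_def
proof (rule convexI, clarsimp, intro conjI allI subsetI)
  fix x y x' y' :: "real ^ 'd" and u v :: real
  assume uv: "0 \<le> u" "0 \<le> v" "u + v = 1"
    and le: "\<forall>i. x $ i \<le> y $ i" "\<forall>i. x' $ i \<le> y' $ i"
    and K: "cbox x y \<subseteq> K" "cbox x' y' \<subseteq> K"
  have mono: "u * x $ i \<le> u * y $ i" "v * x' $ i \<le> v * y' $ i" for i
    using uv le by (auto intro: mult_left_mono)
  show "u * x $ i + v * x' $ i \<le> u * y $ i + v * y' $ i" for i
    using mono by (rule add_mono)
  fix z assume z: "z \<in> cbox (u *\<^sub>R x + v *\<^sub>R x') (u *\<^sub>R y + v *\<^sub>R y')"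
  have "\<exists>\<theta>. 0 \<le> \<theta> \<and> \<theta> \<le> 1 \<and>
      z $ i = u * (x $ i + \<theta> * (y $ i - x $ i)) + v * (x' $ i + \<theta> * (y' $ i - x' $ i))" for i
  proof -
    define l h where "l = u * x $ i + v * x' $ i" and "h = u * y $ i + v * y' $ i"
    have lh: "l \<le> z $ i" "z $ i \<le> h"
      using z by (auto simp: mem_box_cart l_def h_def)
    have "\<exists>\<theta>. 0 \<le> \<theta> \<and> \<theta> \<le> 1 \<and> z $ i = l + \<theta> * (h - l)"
    proof (cases "l = h")
      case True
      then show ?thesis using lh by (intro exI[of _ 0]) auto
    next
      case False
      then show ?thesis
        using lh by (intro exI[of _ "(z $ i - l) / (h - l)"]) (auto simp: divide_simps)
    qed
    then show ?thesis
      by (simp add: l_def h_def algebra_simps)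
  qed
  then obtain \<theta> where \<theta>: "\<And>i. 0 \<le> \<theta> i" "\<And>i. \<theta> i \<le> 1"
      "\<And>i. z $ i = u * (x $ i + \<theta> i * (y $ i - x $ i)) + v * (x' $ i + \<theta> i * (y' $ i - x' $ i))"
    by metis
  have box: "(\<chi> i. a $ i + \<theta> i * (b $ i - a $ i)) \<in> cbox a b" if "\<forall>i. a $ i \<le> b $ i" for a b :: "real ^ 'd"
  proof -
    have "a $ i \<le> a $ i + \<theta> i * (b $ i - a $ i)" "a $ i + \<theta> i * (b $ i - a $ i) \<le> b $ i" for i
      using \<theta>(1,2)[of i] that mult_left_le_one_le[of "b $ i - a $ i" "\<theta> i"] by simp_all
    then show ?thesis by (simp add: mem_box_cart)
  qed
  have "z = u *\<^sub>R (\<chi> i. x $ i + \<theta> i * (y $ i - x $ i)) + v *\<^sub>R (\<chi> i. x' $ i + \<theta> i * (y' $ i - x' $ i))"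
    by (simp add: vec_eq_iff \<theta>(3))
  then show "z \<in> K"
    using convexD[OF assms _ _ uv] box[OF le(1)] box[OF le(2)] K by auto
qed

section \<open>Corner pairs modulo twice the periods\<close>

locale periodic_product =
  fixes A :: "'d::finite \<Rightarrow> real set" and p :: "'d \<Rightarrow> real"
  assumes pos: "0 < p i" and period: "is_period (A i) (p i)" and fin: "finite (A i \<inter> {0..<p i})"
begin

definition Q :: "(real ^ 'd) set" where
  "Q = {x. \<forall>i. x $ i \<in> A i}"

text \<open>This is the set \<open>T\<close>. Requiring the corners to lie in \<open>Q\<close> makes
  it locally finite.\<close>

definition boxes :: "nat \<Rightarrow> ((real ^ 'd) \<times> (real ^ 'd)) set" where
  "boxes n = {(x, y). x \<in> Q \<and> y \<in> Q \<and> (\<forall>i. x $ i \<le> y $ i) \<and> n \<le> card (Q \<inter> cbox x y)}"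

lemma finite_A_Icc: "finite (A i \<inter> {a..b})"
  by (rule finite_periodic_Icc[OF period pos fin])

lemma Q_Int_cbox: "Q \<inter> cbox x y = {z. \<forall>i. z $ i \<in> A i \<inter> {x $ i..y $ i}}"
  by (auto simp: Q_def mem_box_cart)

lemma card_Q_Int_cbox: "card (Q \<inter> cbox x y) = (\<Prod>i\<in>UNIV. card (A i \<inter> {x $ i..y $ i}))"
  unfolding Q_Int_cbox by (rule card_vec_product)

lemma finite_Q_Int_cbox: "finite (Q \<inter> cbox x y)"
  unfolding Q_Int_cbox by (intro finite_vec_product finite_A_Icc)

lemma finite_boxes:
  assumes "bounded B"
  shows "finite (boxes n \<inter> B)"
proof -
  obtain a b where ab: "fst ` B \<union> snd ` B \<subseteq> cbox a b"
    using bounded_subset_cbox_symmetric[of "fst ` B \<union> snd ` B"] assms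
    by (metis bounded_Un bounded_fst bounded_snd)
  have "boxes n \<inter> B \<subseteq> (Q \<inter> cbox a b) \<times> (Q \<inter> cbox a b)"
    using ab by (force simp: boxes_def)
  then show ?thesis
    using finite_subset finite_Q_Int_cbox by blast
qed

text \<open>The modulus is twice the period so that half the difference of congruent coordinates is
  still a period.\<close>

definition residue :: "real ^ 'd \<Rightarrow> real ^ 'd" where
  "residue x = (\<chi> i. x $ i - of_int \<lfloor>x $ i / (2 * p i)\<rfloor> * (2 * p i))"

lemma residue_in:
  assumes "x \<in> Q"
  shows "residue x \<in> {z. \<forall>i. z $ i \<in> A i \<inter> {0..<2 * p i}}"
proof -
  have "x $ i - of_int \<lfloor>x $ i / (2 * p i)\<rfloor> * (2 * p i) \<in> A i \<inter> {0..<2 * p i}" for i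
  proof -
    let ?k = "\<lfloor>x $ i / (2 * p i)\<rfloor>"
    have p2: "0 < 2 * p i"
      using pos[of i] by simp
    have "of_int ?k * (2 * p i) \<le> x $ i"
      using pos_le_divide_eq[OF p2, of "of_int ?k" "x $ i"] by simp
    moreover have "x $ i < (of_int ?k + 1) * (2 * p i)"
      using pos_divide_less_eq[OF p2, of "x $ i" "of_int ?k + 1"] by simp
    moreover have "x $ i + of_int (- 2 * ?k) * p i \<in> A i"
      using is_periodD[OF is_period_int_mult[OF period]] assms unfolding Q_def by blast
    ultimately show ?thesis by (simp add: algebra_simps)
  qed
  then show ?thesis by (simp add: residue_def)
qed

lemma residue_eqE:
  assumes "residue x = residue y"
  obtains u where "\<And>i. is_period (A i) (u $ i)" "y = x + 2 *\<^sub>R u"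
proof
  define u :: "real ^ 'd" where
    "u = (\<chi> i. of_int (\<lfloor>y $ i / (2 * p i)\<rfloor> - \<lfloor>x $ i / (2 * p i)\<rfloor>) * p i)"
  show "is_period (A i) (u $ i)" for i
    unfolding u_def vec_lambda_beta by (rule is_period_int_mult[OF period])
  have "residue x $ i = residue y $ i" for i
    using assms by simp
  then show "y = x + 2 *\<^sub>R u"
    by (simp add: vec_eq_iff u_def residue_def algebra_simps)
qed

text \<open>Equal residues give the second box the corners \<open>x + 2 *\<^sub>R u\<close> and
  \<open>y + 2 *\<^sub>R v\<close> with coordinatewise periods \<open>u\<close> and
  \<open>v\<close>. The midpoint then has corners \<open>x + u\<close> and \<open>y + v\<close>,
  again in \<open>Q\<close>, and its count on each axis is the average.\<close>

lemma midpoint_in_boxes: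
  assumes "(x, y) \<in> boxes n" "(x', y') \<in> boxes n"
    and "residue x = residue x'" "residue y = residue y'"
  shows "midpoint (x, y) (x', y') \<in> boxes n"
proof -
  obtain u where u: "\<And>i. is_period (A i) (u $ i)" and x': "x' = x + 2 *\<^sub>R u"
    using residue_eqE[OF assms(3)] by blast
  obtain v where v: "\<And>i. is_period (A i) (v $ i)" and y': "y' = y + 2 *\<^sub>R v"
    using residue_eqE[OF assms(4)] by blast
  have "midpoint (x, y) (x', y') = (x + u, y + v)"
    by (simp add: midpoint_def x' y' scaleR_add_right vec_eq_iff)
  moreover have "x + u \<in> Q" "y + v \<in> Q"
    using assms(1) is_periodD[OF u] is_periodD[OF v] by (auto simp: boxes_def Q_def)
  moreover have le: "x $ i \<le> y $ i" "x $ i + 2 * u $ i \<le> y $ i + 2 * v $ i" for i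
    using assms(1,2) by (auto simp: boxes_def x' y')
  then have "x $ i + u $ i \<le> y $ i + v $ i" for i
    by (smt (verit))
  moreover have "n \<le> card (Q \<inter> cbox (x + u) (y + v))"
    unfolding card_Q_Int_cbox
  proof (rule prod_card_average_ge)
    show "n \<le> (\<Prod>i\<in>UNIV. card (A i \<inter> {x $ i..y $ i}))"
      "n \<le> (\<Prod>i\<in>UNIV. card (A i \<inter> {x' $ i..y' $ i}))"
      using assms(1,2) by (auto simp: boxes_def card_Q_Int_cbox)
    show "card (A i \<inter> {x $ i..y $ i}) + card (A i \<inter> {x' $ i..y' $ i}) =
        2 * card (A i \<inter> {(x + u) $ i..(y + v) $ i})" for i
      using card_periodic_midpoint[OF u v finite_A_Icc le] by (simp add: x' y')
  qed
  ultimately show ?thesis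
    by (simp add: boxes_def)
qed

text \<open>Pigeonhole on pairs of residues: a double period doubles the count on each axis, which
  gives the factor \<open>2 ^ CARD('d)\<close> per corner, and the two corners square the
  total.\<close>

lemma boxes_contain_midpoint:
  assumes "S \<subseteq> boxes n"
    and "4 ^ CARD('d) * (\<Prod>i\<in>UNIV. card (A i \<inter> {0..<p i}))\<^sup>2 < card S"
  shows "\<exists>s\<in>S. \<exists>t\<in>S. s \<noteq> t \<and> midpoint s t \<in> boxes n"
proof -
  let ?R = "{z :: real ^ 'd. \<forall>i. z $ i \<in> A i \<inter> {0..<2 * p i}}"
  let ?r = "map_prod residue residue"
  have "card ?R = 2 ^ CARD('d) * (\<Prod>i\<in>UNIV. card (A i \<inter> {0..<p i}))"
    unfolding card_vec_product
    by (simp add: card_periodic_double[OF period pos fin] prod.distrib)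
  then have "card (?R \<times> ?R) = 4 ^ CARD('d) * (\<Prod>i\<in>UNIV. card (A i \<inter> {0..<p i}))\<^sup>2"
    unfolding card_cartesian_product
    by (simp add: power2_eq_square flip: power_mult_distrib)
  moreover have "?r ` S \<subseteq> ?R \<times> ?R"
    using assms(1) residue_in by (fastforce simp: boxes_def)
  moreover have "finite (A i \<inter> {0..<2 * p i})" for i
    by (rule finite_subset[OF _ finite_A_Icc[of i 0 "2 * p i"]]) auto
  then have "finite ?R"
    by (rule finite_vec_product)
  ultimately have "card (?r ` S) < card S"
    using card_mono[of "?R \<times> ?R" "?r ` S"] assms(2) by simp
  then obtain s t where "s \<in> S" "t \<in> S" "s \<noteq> t" "?r s = ?r t"
    using pigeonhole[of ?r S] by (auto simp: inj_on_def)
  moreover from this have "midpoint s t \<in> boxes n"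
    using midpoint_in_boxes[of "fst s" "snd s" n "fst t" "snd t"] assms(1)
    by (auto simp: map_prod_def split_beta)
  ultimately show ?thesis by blast
qed

lemma contains_box_with_iff:
  assumes "0 < n"
  shows "contains_box_with Q n K \<longleftrightarrow> (\<exists>t\<in>boxes n. t \<in> box_pairs K)"
proof
  assume "contains_box_with Q n K"
  then obtain x y where xy: "cbox x y \<subseteq> K" "n \<le> card (Q \<inter> cbox x y)"
    using finite_Q_Int_cbox by (auto simp: contains_box_with_def ecard_def)
  define B where "B i = A i \<inter> {x $ i..y $ i}" for i
  \<comment> \<open>Positivity of \<open>n\<close> enters here: \<open>Min\<close> and
    \<open>Max\<close> below need nonempty sets.\<close>
  have "Q \<inter> cbox x y \<noteq> {}"
    using xy(2) assms by force
  then have B: "finite (B i)" "B i \<noteq> {}" for i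
    using finite_A_Icc by (auto simp: B_def Q_Int_cbox)
  \<comment> \<open>The smallest box around the points of \<open>Q\<close> in the given box; as
    \<open>Q\<close> is a product, coordinatewise extremes are again points of
    \<open>Q\<close>.\<close>
  define a b :: "real ^ 'd" where "a = (\<chi> i. Min (B i))" and "b = (\<chi> i. Max (B i))"
  have a: "a $ i \<in> B i" and b: "b $ i \<in> B i" for i
    using Min_in[OF B] Max_in[OF B] by (simp_all add: a_def b_def)
  have between: "a $ i \<le> t" "t \<le> b $ i" if "t \<in> B i" for t i
    using that B(1)[of i] by (simp_all add: a_def b_def)
  have "Q \<inter> cbox x y \<subseteq> Q \<inter> cbox a b"
    unfolding Q_Int_cbox using between by (auto simp: B_def)
  then have "n \<le> card (Q \<inter> cbox a b)"
    using xy(2) card_mono[OF finite_Q_Int_cbox] by (meson order_trans)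
  moreover have "a \<in> Q" "b \<in> Q"
    using a b by (auto simp: Q_def B_def)
  moreover have "x $ i \<le> a $ i" "b $ i \<le> y $ i" for i
    using a[of i] b[of i] by (auto simp: B_def)
  then have "cbox a b \<subseteq> cbox x y"
    unfolding subset_iff mem_box_cart by (meson order_trans)
  moreover have "a $ i \<le> b $ i" for i
    using between(1) b .
  ultimately show "\<exists>t\<in>boxes n. t \<in> box_pairs K"
    using xy(1) by (intro bexI[of _ "(a, b)"]) (auto simp: boxes_def box_pairs_def)
next
  assume "\<exists>t\<in>boxes n. t \<in> box_pairs K"
  then show "contains_box_with Q n K"
    unfolding contains_box_with_def boxes_def box_pairs_def ecard_def by (auto simp: finite_Q_Int_cbox)
qed

lemma box_helly_property_pos:
  assumes "0 < n"
  shows "box_helly_property Q n (4 ^ CARD('d) * (\<Prod>i\<in>UNIV. card (A i \<inter> {0..<p i}))\<^sup>2)"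
    (is "box_helly_property Q n ?N")
  unfolding box_helly_property_def
proof (intro allI impI, elim conjE)
  fix F :: "(real ^ 'd) set set"
  assume F: "finite F" "\<forall>K\<in>F. convex K"
    and sub: "\<forall>G. G \<subseteq> F \<and> card G \<le> ?N \<longrightarrow> contains_box_with Q n (\<Inter>G)"
  \<comment> \<open>For empty \<open>G\<close> the left side still demands ordered corners, which
    \<open>t \<in> boxes n\<close> supplies.\<close>
  have Inter: "t \<in> box_pairs (\<Inter>G) \<longleftrightarrow> (\<forall>K\<in>G. t \<in> box_pairs K)" if "t \<in> boxes n" for t G
    using that by (cases t) (auto simp: boxes_def box_pairs_def)
  have "\<exists>t\<in>boxes n. \<forall>K\<in>F. t \<in> box_pairs K"
  proof (rule helly_locally_finite[OF finite_boxes boxes_contain_midpoint])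
    show "\<exists>t\<in>boxes n. \<forall>K\<in>G. t \<in> box_pairs K" if "G \<subseteq> F" "card G \<le> ?N" for G
    proof -
      have "\<exists>t\<in>boxes n. t \<in> box_pairs (\<Inter>G)"
        using sub that unfolding contains_box_with_iff[OF assms, symmetric] by blast
      then show ?thesis using Inter by blast
    qed
  qed (use F convex_box_pairs in auto)
  then show "contains_box_with Q n (\<Inter>F)"
    unfolding contains_box_with_iff[OF assms] using Inter by blast
qed

end

section \<open>Boxes with no required points, and infinite products in \<open>enat\<close>\<close>

lemma contains_box_with_0_iff: "contains_box_with S 0 K \<longleftrightarrow> K \<noteq> {}"
proof
  assume "contains_box_with S 0 K"
  then obtain x y where "\<forall>i. x $ i \<le> y $ i" "cbox x y \<subseteq> K"
    by (auto simp: contains_box_with_def)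
  then have "x \<in> K" by (auto simp: mem_box_cart)
  then show "K \<noteq> {}" by blast
next
  assume "K \<noteq> {}"
  then obtain x where "x \<in> K" by blast
  then show "contains_box_with S 0 K"
    by (auto simp: contains_box_with_def cbox_idem zero_enat_def[symmetric] intro!: exI[of _ x])
qed

lemma box_helly_property_0:
  fixes S :: "(real ^ 'd) set"
  assumes "CARD('d) + 1 \<le> h"
  shows "box_helly_property S 0 h"
  unfolding box_helly_property_def contains_box_with_0_iff
proof (intro allI impI, elim conjE)
  fix F :: "(real ^ 'd) set set"
  assume F: "finite F" "\<forall>K\<in>F. convex K"
    and sub: "\<forall>G. G \<subseteq> F \<and> card G \<le> h \<longrightarrow> \<Inter>G \<noteq> {}"
  show "\<Inter>F \<noteq> {}"
  \<comment> \<open>A family of at most \<open>h\<close> sets is itself an admissible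
    \<open>G\<close>; a larger one meets the cardinality premise of \<open>Helly\<close>.\<close>
  proof (cases "card F \<le> h")
    case True
    then show ?thesis using sub by blast
  next
    case False
    show ?thesis
    proof (rule Helly[OF _ F(2)])
      show "DIM(real ^ 'd) + 1 \<le> card F"
        using False assms by simp
      show "\<Inter>G \<noteq> {}" if "G \<subseteq> F" "card G = DIM(real ^ 'd) + 1" for G
        using sub that assms by simp
    qed
  qed
qed

lemma box_helly_number_le: "box_helly_property S n h \<Longrightarrow> box_helly_number S n \<le> enat h"
  by (auto simp: box_helly_number_def intro: Least_le)

text \<open>In \<open>enat\<close>, \<open>\<infinity> * 0 = 0\<close>, so an infinite factor
  decides the product only if no factor vanishes.\<close>

lemma prod_eq_infinity:
  fixes f :: "'i \<Rightarrow> enat"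
  assumes "finite I" "i \<in> I" "f i = \<infinity>" "\<And>j. j \<in> I \<Longrightarrow> f j \<noteq> 0"
  shows "prod f I = \<infinity>"
proof -
  have "prod f I = \<infinity> * prod f (I - {i})"
    using assms by (simp add: prod.remove)
  moreover have "(\<forall>j\<in>J. f j \<noteq> 0) \<Longrightarrow> prod f J \<noteq> 0" if "finite J" for J
    using that by (induction J) auto
  then have "prod f (I - {i}) \<noteq> 0"
    using assms by simp
  ultimately show ?thesis by (simp add: imult_is_infinity)
qed

text \<open>The second assumption excludes \<open>Q = {}\<close> with \<open>n = 0\<close>. There
  the bound is 0, but \<open>h = 0\<close> fails for the family \<open>{{}}\<close>: the empty
  subfamily has the whole space as its intersection, while the full intersection is empty.\<close>

theorem theorem2p14:
  fixes Q :: "(real ^ 'd) set" and n :: nat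
  assumes "periodic_product_set Q"
    and "Q \<noteq> {} \<or> n \<noteq> 0"
  shows "box_helly_number Q n \<le> 4 ^ CARD('d) * rho Q ^ 2"
proof (cases "Q = {}")
  case True
  then have "\<not> contains_box_with Q n K" for K
    using assms(2) by (simp add: contains_box_with_def ecard_def enat_0_iff)
  \<comment> \<open>No set contains a suitable box, so the premise already fails at the empty
    subfamily.\<close>
  then have "box_helly_property Q n 0"
    unfolding box_helly_property_def by (metis bot_least card.empty order_refl)
  then show ?thesis
    using box_helly_number_le[of Q n 0] by (simp add: zero_enat_def[symmetric])
next
  case False
  obtain A where A: "\<And>i. periodic (A i)" and Q: "Q = {x. \<forall>i. x $ i \<in> A i}"
    using assms(1) by (auto simp: periodic_product_set_def)
  define p where "p i = least_period (A i)" for i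
  obtain q where q: "\<And>i. q $ i \<in> A i"
    using False Q by auto
  have "factor Q i = A i" for i
  proof
    show "A i \<subseteq> factor Q i"
    proof
      fix t assume "t \<in> A i"
      then have "(\<chi> j. if j = i then t else q $ j) \<in> Q"
        using q by (simp add: Q)
      then show "t \<in> factor Q i"
        unfolding factor_def by (rule rev_image_eqI) simp
    qed
  qed (auto simp: factor_def Q)
  then have m: "points_per_period Q i = ecard (A i \<inter> {0..<p i})" for i
    by (simp add: points_per_period_def p_def)
  have p: "0 < p i" "is_period (A i) (p i)" for i
    using least_period[OF A, of i] q by (auto simp: p_def)
  \<comment> \<open>Translating \<open>q $ i\<close> by whole periods gives a point in the
    fundamental interval. Hence no factor of \<open>rho Q\<close> vanishes, which serves both the
    case \<open>n = 0\<close> and the case of an infinite factor.\<close>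
  have ne: "A i \<inter> {0..<p i} \<noteq> {}" for i
  proof -
    let ?k = "\<lfloor>q $ i / p i\<rfloor>"
    have "of_int ?k * p i \<le> q $ i"
      using pos_le_divide_eq[OF p(1), of "of_int ?k" "q $ i" i] by simp
    moreover have "q $ i < (of_int ?k + 1) * p i"
      using pos_divide_less_eq[OF p(1), of "q $ i" i "of_int ?k + 1"] by simp
    moreover have "q $ i + of_int (- ?k) * p i \<in> A i"
      using is_periodD[OF is_period_int_mult[OF p(2)]] q by blast
    ultimately have "q $ i + of_int (- ?k) * p i \<in> A i \<inter> {0..<p i}"
      by (simp add: algebra_simps)
    then show ?thesis by blast
  qed
  then have m0: "points_per_period Q i \<noteq> 0" for i
    by (simp add: m ecard_def enat_0_iff)
  show ?thesis
  proof (cases "\<forall>i. finite (A i \<inter> {0..<p i})")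
    case True
    interpret P: periodic_product A p
      using p True by unfold_locales auto
    have PQ: "P.Q = Q"
      by (simp add: P.Q_def Q)
    let ?r = "\<Prod>i\<in>UNIV. card (A i \<inter> {0..<p i})"
    let ?h = "4 ^ CARD('d) * ?r\<^sup>2"
    have "rho Q = enat ?r"
      using True by (simp add: rho_def m ecard_def flip: of_nat_eq_enat)
    then have "4 ^ CARD('d) * rho Q ^ 2 = enat ?h"
      by (simp flip: of_nat_eq_enat)
    moreover have "box_helly_property Q n ?h"
    proof (cases "n = 0")
      case True
      have "0 < ?r"
        using \<open>\<forall>i. finite (A i \<inter> {0..<p i})\<close> ne by (intro prod_pos) (simp add: card_gt_0_iff)
      then have "1 \<le> ?r\<^sup>2"
        by (metis One_nat_def Suc_leI one_le_power)
      \<comment> \<open>The bound must reach the classical Helly number \<open>CARD('d) + 1\<close>;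
        this uses \<open>d < 2^d \<le> 4^d\<close>.\<close>
      moreover have "CARD('d) + 1 \<le> (4::nat) ^ CARD('d)"
        using less_exp[of "CARD('d)"] power_mono[of 2 "4::nat" "CARD('d)"] by linarith
      ultimately have "CARD('d) + 1 \<le> ?h"
        by (metis mult_le_mono mult.right_neutral)
      then show ?thesis
        using True box_helly_property_0 by blast
    next
      case False
      then show ?thesis
        using P.box_helly_property_pos by (simp add: PQ)
    qed
    ultimately show ?thesis
      using box_helly_number_le by metis
  next
    \<comment> \<open>A discrete factor can accumulate within one period; the bound is then
      infinite.\<close>
    case False
    then obtain i where "points_per_period Q i = \<infinity>"
      by (auto simp: m ecard_def)
    then have "rho Q = \<infinity>"
      unfolding rho_def using m0 by (intro prod_eq_infinity[of _ i]) auto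
    moreover have "(4 :: enat) ^ k \<noteq> 0" for k
      by (induction k) auto
    ultimately have "4 ^ CARD('d) * rho Q ^ 2 = \<infinity>"
      by (simp add: power2_eq_square imult_is_infinity)
    then show ?thesis by simp
  qed
qed

end
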